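(* Every locally confluent, regular, terminating evolution system is confluent.
   Context: An evolution system is a structure $\mathcal{E} = \langle \mathfrak{V}, \mathcal{T}, \Theta\rangle$ where $\mathfrak{V}$ is a (locally small) category, $\Theta$ is a fixed $\mathfrak{V}$-object (the origin), and $\mathcal{T}$ is a class of $\mathfrak{V}$-arrows (transitions) such that all identities are in $\mathcal{T}$, and $h\circ t \in \mathcal{T}$ whenever $t \in \mathcal{T}$ and $h$ is an isomorphism of $\mathfrak{V}$ with $h \circ t$ defined (so all isomorphisms are transitions). Standing assumption: every evolution has a colimit in $\mathfrak{V}$. An evolution is a functor $\vec e$ from $\omega$ (as a poset category) to $\mathfrak{V}$, with objects $E_n$, such that $E_0=\Theta$ and each arrow $E_n\to E_{n+1}$ is a transition. A path is a finite composition of transitions. An object $X$ is finite if there is a path from $\Theta$ to $X$. $\mathcal{E}$ is regular if $t\circ h$ is a transition whenever $t$ is a transition and $h$ is an isomorphism such that $t\circ h$ is defined. $\mathcal{E}$ is locally confluent if for every finite object $X$ and every two transitions $f,g$ with domain $X$ there exist paths $f',g'$ such that $f'\circ f = g'\circ g$. $\mathcal{E}$ is confluent if the category of finite objects with paths has the amalgamation property: for every two paths $f,g$ with the same finite domain there exist paths $f',g'$ with $f'\circ f=g'\circ g$. $\mathcal{E}$ is terminating if every evolution is eventually trivial, i.e. from some point on all the transitions $E_n\to E_{n+1}$ are isomorphisms. *)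

theory Defs
  imports Main
begin

text \<open>
  Categories are given by carrier sets of objects and arrows, in the style of HOL-Algebra.
  The type parameters are arbitrary, so objects and arrows may be as numerous as desired; hom-sets
  are sets automatically, which is what local smallness amounts to here.
  Composition is written in the applicative order and is meaningful only for composable arrows
  of the carrier.
\<close>

record ('o, 'a) cat =
  Obj :: "'o set"
  Arr :: "'a set"
  Dom :: "'a \<Rightarrow> 'o"
  Cod :: "'a \<Rightarrow> 'o"
  Ide :: "'o \<Rightarrow> 'a"
  Comp :: "'a \<Rightarrow> 'a \<Rightarrow> 'a" (infixr "\<cdot>\<index>" 70)

definition Hom :: "('o, 'a, 'm) cat_scheme \<Rightarrow> 'o \<Rightarrow> 'o \<Rightarrow> 'a set" where
  "Hom V X Y = {f \<in> Arr V. Dom V f = X \<and> Cod V f = Y}"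

locale category =
  fixes V :: "('o, 'a, 'm) cat_scheme" (structure)
  assumes Dom_closed: "f \<in> Arr V \<Longrightarrow> Dom V f \<in> Obj V"
    and Cod_closed: "f \<in> Arr V \<Longrightarrow> Cod V f \<in> Obj V"
    and Ide_Hom: "X \<in> Obj V \<Longrightarrow> Ide V X \<in> Hom V X X"
    and Comp_Hom: "\<lbrakk>f \<in> Hom V X Y; g \<in> Hom V Y Z\<rbrakk> \<Longrightarrow> g \<cdot> f \<in> Hom V X Z"
    and Comp_Ide: "f \<in> Hom V X Y \<Longrightarrow> f \<cdot> Ide V X = f"
    and Ide_Comp: "f \<in> Hom V X Y \<Longrightarrow> Ide V Y \<cdot> f = f"
    and Comp_assoc: "\<lbrakk>f \<in> Hom V W X; g \<in> Hom V X Y; h \<in> Hom V Y Z\<rbrakk>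
      \<Longrightarrow> (h \<cdot> g) \<cdot> f = h \<cdot> (g \<cdot> f)"

definition iso :: "('o, 'a, 'm) cat_scheme \<Rightarrow> 'a \<Rightarrow> bool" where
  "iso V f \<longleftrightarrow> f \<in> Arr V \<and> (\<exists>g \<in> Hom V (Cod V f) (Dom V f).
     g \<cdot>\<^bsub>V\<^esub> f = Ide V (Dom V f) \<and> f \<cdot>\<^bsub>V\<^esub> g = Ide V (Cod V f))"

text \<open>
  A functor from the poset category \<open>\<omega>\<close> has an object \<open>E n\<close> for every \<open>n\<close> and, for every
  \<open>m \<le> n\<close>, an arrow \<open>e m n\<close> from \<open>E m\<close> to \<open>E n\<close>; values of \<open>e m n\<close> for \<open>m > n\<close> are junk.
\<close>

definition omega_functor ::
  "('o, 'a, 'm) cat_scheme \<Rightarrow> (nat \<Rightarrow> 'o) \<Rightarrow> (nat \<Rightarrow> nat \<Rightarrow> 'a) \<Rightarrow> bool" where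
  "omega_functor V E e \<longleftrightarrow>
     (\<forall>n. E n \<in> Obj V) \<and>
     (\<forall>m n. m \<le> n \<longrightarrow> e m n \<in> Hom V (E m) (E n)) \<and>
     (\<forall>n. e n n = Ide V (E n)) \<and>
     (\<forall>k m n. k \<le> m \<and> m \<le> n \<longrightarrow> e k n = e m n \<cdot>\<^bsub>V\<^esub> e k m)"

definition omega_cocone ::
  "('o, 'a, 'm) cat_scheme \<Rightarrow> (nat \<Rightarrow> 'o) \<Rightarrow> (nat \<Rightarrow> nat \<Rightarrow> 'a) \<Rightarrow> 'o \<Rightarrow> (nat \<Rightarrow> 'a) \<Rightarrow> bool" where
  "omega_cocone V E e C c \<longleftrightarrow>
     C \<in> Obj V \<and>
     (\<forall>n. c n \<in> Hom V (E n) C) \<and>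
     (\<forall>m n. m \<le> n \<longrightarrow> c n \<cdot>\<^bsub>V\<^esub> e m n = c m)"

definition omega_colimit ::
  "('o, 'a, 'm) cat_scheme \<Rightarrow> (nat \<Rightarrow> 'o) \<Rightarrow> (nat \<Rightarrow> nat \<Rightarrow> 'a) \<Rightarrow> 'o \<Rightarrow> (nat \<Rightarrow> 'a) \<Rightarrow> bool" where
  "omega_colimit V E e C c \<longleftrightarrow>
     omega_cocone V E e C c \<and>
     (\<forall>D d. omega_cocone V E e D d \<longrightarrow>
        (\<exists>!u. u \<in> Hom V C D \<and> (\<forall>n. u \<cdot>\<^bsub>V\<^esub> c n = d n)))"

record ('o, 'a) evsys = "('o, 'a) cat" +
  Trans :: "'a set"
  Origin :: 'o

definition evolution ::
  "('o, 'a, 'm) evsys_scheme \<Rightarrow> (nat \<Rightarrow> 'o) \<Rightarrow> (nat \<Rightarrow> nat \<Rightarrow> 'a) \<Rightarrow> bool" where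
  "evolution S E e \<longleftrightarrow>
     omega_functor S E e \<and> E 0 = Origin S \<and> (\<forall>n. e n (Suc n) \<in> Trans S)"

locale evolution_system = category S for S :: "('o, 'a, 'm) evsys_scheme" (structure) +
  assumes Origin_Obj: "Origin S \<in> Obj S"
    and Trans_Arr: "Trans S \<subseteq> Arr S"
    and Ide_Trans: "X \<in> Obj S \<Longrightarrow> Ide S X \<in> Trans S"
    and iso_Comp_Trans: "\<lbrakk>t \<in> Trans S; iso S h; Dom S h = Cod S t\<rbrakk> \<Longrightarrow> h \<cdot> t \<in> Trans S"
    and evolution_colimit: "evolution S E e \<Longrightarrow> \<exists>C c. omega_colimit S E e C c"

text \<open>
  The empty composition at \<open>X\<close> is \<open>Ide S X\<close>, which is itself a transition in an evolution system;
  hence it suffices to generate the nonempty compositions.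
\<close>

inductive path :: "('o, 'a, 'm) evsys_scheme \<Rightarrow> 'a \<Rightarrow> bool" for S where
  Trans: "t \<in> Trans S \<Longrightarrow> path S t"
| Comp: "\<lbrakk>path S p; t \<in> Trans S; Dom S t = Cod S p\<rbrakk> \<Longrightarrow> path S (t \<cdot>\<^bsub>S\<^esub> p)"

definition finite_obj :: "('o, 'a, 'm) evsys_scheme \<Rightarrow> 'o \<Rightarrow> bool" where
  "finite_obj S X \<longleftrightarrow> (\<exists>p. path S p \<and> Dom S p = Origin S \<and> Cod S p = X)"

definition regular :: "('o, 'a, 'm) evsys_scheme \<Rightarrow> bool" where
  "regular S \<longleftrightarrow>
     (\<forall>t h. t \<in> Trans S \<and> iso S h \<and> Dom S t = Cod S h \<longrightarrow> t \<cdot>\<^bsub>S\<^esub> h \<in> Trans S)"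

definition path_amalgamable :: "('o, 'a, 'm) evsys_scheme \<Rightarrow> 'a \<Rightarrow> 'a \<Rightarrow> bool" where
  "path_amalgamable S f g \<longleftrightarrow>
     (\<exists>f' g'. path S f' \<and> path S g' \<and> Dom S f' = Cod S f \<and> Dom S g' = Cod S g \<and>
        f' \<cdot>\<^bsub>S\<^esub> f = g' \<cdot>\<^bsub>S\<^esub> g)"

definition locally_confluent :: "('o, 'a, 'm) evsys_scheme \<Rightarrow> bool" where
  "locally_confluent S \<longleftrightarrow>
     (\<forall>X f g. finite_obj S X \<and> f \<in> Trans S \<and> g \<in> Trans S \<and> Dom S f = X \<and> Dom S g = X \<longrightarrow>
        path_amalgamable S f g)"

definition confluent :: "('o, 'a, 'm) evsys_scheme \<Rightarrow> bool" where
  "confluent S \<longleftrightarrow>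
     (\<forall>X f g. finite_obj S X \<and> path S f \<and> path S g \<and> Dom S f = X \<and> Dom S g = X \<longrightarrow>
        path_amalgamable S f g)"

definition terminating :: "('o, 'a, 'm) evsys_scheme \<Rightarrow> bool" where
  "terminating S \<longleftrightarrow>
     (\<forall>E e. evolution S E e \<longrightarrow> (\<exists>N. \<forall>n\<ge>N. iso S (e n (Suc n))))"

end

theory Submission
  imports Defs
begin

text \<open>
  The argument is Newman's lemma. Termination makes the relation ``there is a transition from
  \<open>X\<close> to \<open>Y\<close> that is not an isomorphism'' well-founded on finite objects: an infinite chain,
  preceded by a path from the origin, would be an evolution that is not eventually trivial.
  Isomorphisms would break the induction, but by regularity they can be absorbed into the next
  transition, so that a path is either an isomorphism or starts with a transition that is not one.
\<close>

section \<open>Composition laws phrased with \<open>Dom\<close> and \<open>Cod\<close>, and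
  inverses\<close>

context category
begin

lemma Hom_iff: "f \<in> Hom V X Y \<longleftrightarrow> f \<in> Arr V \<and> Dom V f = X \<and> Cod V f = Y"
  by (simp add: Hom_def)

text \<open>The axioms speak of \<open>Hom\<close> with intermediate objects that do not occur in
  the conclusion. Side conditions on \<open>Dom\<close> and \<open>Cod\<close> contain only the
  arrows themselves, so the simplifier can discharge them.\<close>

lemma Comp_Arr:
  assumes "f \<in> Arr V" "g \<in> Arr V" "Dom V g = Cod V f"
  shows "g \<cdot> f \<in> Arr V" "Dom V (g \<cdot> f) = Dom V f" "Cod V (g \<cdot> f) = Cod V g"
  using Comp_Hom[of f "Dom V f" "Cod V f" g "Cod V g"] assms by (auto simp: Hom_iff)

lemma Comp_assoc_Arr:
  assumes "f \<in> Arr V" "g \<in> Arr V" "h \<in> Arr V" "Dom V g = Cod V f" "Dom V h = Cod V g"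
  shows "(h \<cdot> g) \<cdot> f = h \<cdot> (g \<cdot> f)"
  by (rule Comp_assoc) (use assms in \<open>auto simp: Hom_iff\<close>)

lemma Ide_Arr:
  assumes "X \<in> Obj V"
  shows "Ide V X \<in> Arr V" "Dom V (Ide V X) = X" "Cod V (Ide V X) = X"
  using Ide_Hom[OF assms] by (auto simp: Hom_iff)

lemma Comp_Ide_Arr: "f \<in> Arr V \<Longrightarrow> Dom V f = X \<Longrightarrow> f \<cdot> Ide V X = f"
  by (rule Comp_Ide) (auto simp: Hom_iff)

lemma Ide_Comp_Arr: "f \<in> Arr V \<Longrightarrow> Cod V f = Y \<Longrightarrow> Ide V Y \<cdot> f = f"
  by (rule Ide_Comp) (auto simp: Hom_iff)

lemma iso_inverse:
  assumes "iso V f"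
  obtains g where "iso V g" "Dom V g = Cod V f" "Cod V g = Dom V f"
    "g \<cdot> f = Ide V (Dom V f)" "f \<cdot> g = Ide V (Cod V f)"
proof -
  obtain g where g: "g \<in> Hom V (Cod V f) (Dom V f)"
    "g \<cdot> f = Ide V (Dom V f)" "f \<cdot> g = Ide V (Cod V f)"
    using assms unfolding iso_def by blast
  moreover have "f \<in> Hom V (Dom V f) (Cod V f)"
    using assms by (simp add: iso_def Hom_iff)
  ultimately have "iso V g"
    unfolding iso_def by (auto simp: Hom_iff)
  with g that show ?thesis by (simp add: Hom_iff)
qed

end

text \<open>A counterexample to termination, stored only as its generating arrows. The start
  \<open>X\<close> is left free, because a chain found at some finite object is moved to the origin
  by prepending a path.\<close>

definition ray :: "('o, 'a, 'm) evsys_scheme \<Rightarrow> 'o \<Rightarrow> (nat \<Rightarrow> 'a) \<Rightarrow> bool" where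
  "ray S X u \<longleftrightarrow> Dom S (u 0) = X \<and>
     (\<forall>n. u n \<in> Trans S \<and> Dom S (u (Suc n)) = Cod S (u n)) \<and>
     (\<forall>n. \<exists>m\<ge>n. \<not> iso S (u m))"

lemma ray_extend_Trans:
  assumes "t \<in> Trans S" "ray S (Cod S t) u"
  shows "ray S (Dom S t) (case_nat t u)"
proof -
  have "\<exists>m\<ge>n. \<not> iso S (case_nat t u m)" for n
  proof -
    from assms(2) obtain m where "m \<ge> n" "\<not> iso S (u m)"
      unfolding ray_def by blast
    then show ?thesis
      by (intro exI[of _ "Suc m"]) simp
  qed
  then show ?thesis
    using assms by (auto simp: ray_def split: nat.split)
qed

text \<open>The functor on omega generated by \<open>u\<close>, with objects
  \<open>Dom S (u n)\<close>. The \<open>else\<close> branch matters for \<open>m = Suc n\<close>,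
  where it supplies the identity; for larger \<open>m\<close> its value is junk.\<close>

primrec ray_arrow :: "('o, 'a, 'm) evsys_scheme \<Rightarrow> (nat \<Rightarrow> 'a) \<Rightarrow> nat \<Rightarrow> nat \<Rightarrow> 'a" where
  "ray_arrow S u m 0 = Ide S (Dom S (u 0))"
| "ray_arrow S u m (Suc n) =
     (if m \<le> n then u n \<cdot>\<^bsub>S\<^esub> ray_arrow S u m n else Ide S (Dom S (u (Suc n))))"

section \<open>Paths and their first non-isomorphic transition\<close>

context evolution_system
begin

lemma Trans_is_Arr: "t \<in> Trans S \<Longrightarrow> t \<in> Arr S"
  using Trans_Arr by blast

lemma path_Arr: "path S p \<Longrightarrow> p \<in> Arr S"
  by (induction rule: path.induct) (auto simp: Trans_is_Arr Comp_Arr)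

lemma path_Comp:
  assumes "path S q" "path S p" "Dom S q = Cod S p"
  shows "path S (q \<cdot> p)"
  using assms
proof (induction rule: path.induct)
  case (Trans t)
  then show ?case by (auto intro: path.Comp)
next
  case (Comp q t)
  then have dom: "Dom S q = Cod S p"
    by (simp add: Comp_Arr Trans_is_Arr path_Arr)
  with Comp have "path S (t \<cdot> (q \<cdot> p))"
    by (simp add: path.Comp Comp_Arr path_Arr)
  with dom show ?case
    using Comp by (simp add: Comp_assoc_Arr Comp_Arr Trans_is_Arr path_Arr)
qed

lemma path_Ide: "X \<in> Obj S \<Longrightarrow> path S (Ide S X)"
  by (intro path.Trans Ide_Trans)

lemma iso_Trans:
  assumes "iso S h"
  shows "h \<in> Trans S"
proof -
  have "h \<in> Arr S" using assms by (simp add: iso_def)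
  then show ?thesis
    using iso_Comp_Trans[OF Ide_Trans assms, of "Dom S h"] by (simp add: Dom_closed Ide_Arr Comp_Ide_Arr)
qed

lemma finite_obj_Cod:
  assumes "finite_obj S (Dom S p)" "path S p"
  shows "finite_obj S (Cod S p)"
proof -
  obtain q where "path S q" "Dom S q = Origin S" "Cod S q = Dom S p"
    using assms(1) by (auto simp: finite_obj_def)
  with assms(2) have "path S (p \<cdot> q)" "Dom S (p \<cdot> q) = Origin S" "Cod S (p \<cdot> q) = Cod S p"
    by (simp_all add: path_Comp Comp_Arr path_Arr)
  then show ?thesis by (auto simp: finite_obj_def)
qed

text \<open>Paths grow at the codomain end, whereas the split is wanted at the domain end. If the
  path so far is an isomorphism, regularity merges it with the next transition into a single
  transition; otherwise the first factor already found stays first and the new transition joins the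
  rest.\<close>

lemma path_cases:
  assumes "regular S" "path S p"
  obtains "iso S p"
  | p' t where "t \<in> Trans S" "\<not> iso S t" "path S p'" "Dom S p' = Cod S t" "p = p' \<cdot> t"
proof -
  have split: "\<exists>p' t. t \<in> Trans S \<and> \<not> iso S t \<and> path S p' \<and> Dom S p' = Cod S t \<and> q = p' \<cdot> t"
    if q: "q \<in> Trans S" "\<not> iso S q" for q
  proof -
    have "Cod S q \<in> Obj S" using q by (simp add: Cod_closed Trans_is_Arr)
    with q show ?thesis
      by (intro exI[of _ "Ide S (Cod S q)"] exI[of _ q])
        (simp add: path_Ide Ide_Arr Ide_Comp_Arr Trans_is_Arr)
  qed
  have "iso S p \<or>
    (\<exists>p' t. t \<in> Trans S \<and> \<not> iso S t \<and> path S p' \<and> Dom S p' = Cod S t \<and> p = p' \<cdot> t)"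
    using assms(2)
  proof (induction rule: path.induct)
    case (Trans t)
    then show ?case using split by blast
  next
    case (Comp p t)
    show ?case
    proof (cases "iso S p")
      case True
      then have "t \<cdot> p \<in> Trans S"
        using Comp assms(1) by (auto simp: regular_def)
      then show ?thesis using split by blast
    next
      case False
      with Comp.IH obtain p' s where s: "s \<in> Trans S" "\<not> iso S s" "path S p'"
        "Dom S p' = Cod S s" "p = p' \<cdot> s" by blast
      then have t: "Dom S t = Cod S p'"
        using Comp by (simp add: Comp_Arr Trans_is_Arr path_Arr)
      have "path S (t \<cdot> p')" "Dom S (t \<cdot> p') = Cod S s" "t \<cdot> p = (t \<cdot> p') \<cdot> s"
        using s t Comp by (simp_all add: path.Comp Comp_Arr Trans_is_Arr path_Arr Comp_assoc_Arr)
      with s show ?thesis by blast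
    qed
  qed
  then show ?thesis using that by blast
qed

text \<open>The last transition of the path is the first one put in front of \<open>u\<close>; the
  induction hypothesis then applies to the longer ray, hence the generalization over
  \<open>u\<close>.\<close>

lemma ray_extend_path:
  assumes "path S p" "ray S (Cod S p) u"
  shows "\<exists>v. ray S (Dom S p) v"
  using assms
proof (induction arbitrary: u rule: path.induct)
  case (Trans t)
  from ray_extend_Trans[OF this] show ?case by blast
next
  case (Comp p t)
  then have "ray S (Cod S t) u"
    by (simp add: Comp_Arr Trans_is_Arr path_Arr)
  from ray_extend_Trans[OF Comp.hyps(2) this] have "ray S (Cod S p) (case_nat t u)"
    using Comp by simp
  then show ?case
    using Comp by (simp add: Comp_Arr Trans_is_Arr path_Arr)
qed

section \<open>From rays to evolutions, and well-foundedness\<close>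

lemma ray_arrow_Hom:
  assumes "ray S X u" "m \<le> n"
  shows "ray_arrow S u m n \<in> Hom S (Dom S (u m)) (Dom S (u n))"
  using assms(2)
proof (induction n)
  case 0
  have "Dom S (u 0) \<in> Obj S"
    using assms(1) by (auto simp: ray_def Trans_is_Arr intro: Dom_closed)
  then show ?case using 0 by (simp add: Ide_Hom)
next
  case (Suc n)
  have u: "u n \<in> Hom S (Dom S (u n)) (Dom S (u (Suc n)))"
      "Dom S (u (Suc n)) \<in> Obj S"
    using assms(1) Dom_closed[of "u (Suc n)"] by (simp_all add: ray_def Hom_iff Trans_is_Arr)
  show ?case
  proof (cases "m \<le> n")
    case True
    then show ?thesis using Suc u by (auto intro: Comp_Hom)
  next
    case False
    then have "m = Suc n" using Suc.prems by simp
    then show ?thesis using u by (simp add: Ide_Hom)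
  qed
qed

lemma ray_arrow_refl: "ray_arrow S u n n = Ide S (Dom S (u n))"
  by (cases n) simp_all

lemma ray_arrow_Comp:
  assumes "ray S X u" "k \<le> m" "m \<le> n"
  shows "ray_arrow S u k n = ray_arrow S u m n \<cdot> ray_arrow S u k m"
  using assms(3)
proof (induction n rule: dec_induct)
  case base
  then show ?case
    using Ide_Comp[OF ray_arrow_Hom[OF assms(1,2)]] by (simp add: ray_arrow_refl)
next
  case (step n)
  have u: "u n \<in> Hom S (Dom S (u n)) (Dom S (u (Suc n)))"
    using assms(1) by (auto simp: ray_def Hom_iff Trans_is_Arr)
  show ?case
    using step assms(2)
      Comp_assoc[OF ray_arrow_Hom[OF assms(1,2)] ray_arrow_Hom[OF assms(1) step.hyps(1)] u]
    by simp
qed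

lemma ray_evolution:
  assumes "ray S (Origin S) u"
  shows "evolution S (\<lambda>n. Dom S (u n)) (ray_arrow S u)"
    and "ray_arrow S u n (Suc n) = u n"
proof -
  show u: "ray_arrow S u n (Suc n) = u n" for n
    using assms by (simp add: ray_arrow_refl ray_def Comp_Ide_Arr Trans_is_Arr)
  have Trans: "u n \<in> Trans S" for n
    using assms by (simp add: ray_def)
  show "evolution S (\<lambda>n. Dom S (u n)) (ray_arrow S u)"
    unfolding evolution_def omega_functor_def u
  proof (intro conjI allI impI)
    show "Dom S (u n) \<in> Obj S" for n
      by (intro Dom_closed Trans_is_Arr Trans)
    show "Dom S (u 0) = Origin S"
      using assms by (simp add: ray_def)
    show "ray_arrow S u k n = ray_arrow S u m n \<cdot> ray_arrow S u k m" if "k \<le> m \<and> m \<le> n" for k m n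
      using that by (intro ray_arrow_Comp[OF assms]) simp_all
  qed (rule ray_arrow_refl Trans ray_arrow_Hom[OF assms] | assumption)+
qed

lemma terminating_no_ray:
  assumes "terminating S"
  shows "\<not> ray S (Origin S) u"
proof
  assume u: "ray S (Origin S) u"
  then obtain N where "\<forall>n\<ge>N. iso S (u n)"
    using assms ray_evolution[OF u] unfolding terminating_def by metis
  with u show False by (auto simp: ray_def)
qed

text \<open>The target comes first, so targets count as smaller in the well-founded order. Sources
  are restricted to finite objects because termination only controls sequences that start at the
  origin.\<close>

definition proper_step :: "('o \<times> 'o) set" where
  "proper_step = {(Y, X). finite_obj S X \<and> (\<exists>t\<in>Trans S. \<not> iso S t \<and> Dom S t = X \<and> Cod S t = Y)}"

lemma wf_proper_step:
  assumes "terminating S"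
  shows "wf proper_step"
  unfolding wf_iff_no_infinite_down_chain
proof
  assume "\<exists>X. \<forall>i. (X (Suc i), X i) \<in> proper_step"
  then obtain X where X: "\<And>i. (X (Suc i), X i) \<in> proper_step" by blast
  then have "\<forall>i. \<exists>t\<in>Trans S. \<not> iso S t \<and> Dom S t = X i \<and> Cod S t = X (Suc i)"
    by (auto simp: proper_step_def)
  then obtain u where
    u: "\<And>i. u i \<in> Trans S" "\<And>i. \<not> iso S (u i)" "\<And>i. Dom S (u i) = X i"
       "\<And>i. Cod S (u i) = X (Suc i)"
    by metis
  have ray: "ray S (X 0) u" using u by (auto simp: ray_def)
  \<comment> \<open>A path from the origin to \<open>X 0\<close> turns the chain into a ray at the
    origin, which termination forbids.\<close>
  have "finite_obj S (X 0)" using X[of 0] by (simp add: proper_step_def)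
  then obtain p where "path S p" "Dom S p = Origin S" "Cod S p = X 0"
    by (auto simp: finite_obj_def)
  with ray_extend_path[of p u] ray terminating_no_ray[OF assms] show False by auto
qed

section \<open>Amalgamation by pasting squares\<close>

lemma path_amalgamable_sym: "path_amalgamable S f g \<Longrightarrow> path_amalgamable S g f"
  unfolding path_amalgamable_def by metis

text \<open>With \<open>h\<close> inverse to \<open>f\<close>, the span is closed by
  \<open>g \<cdot> h\<close> on one side and an identity on the other.\<close>

lemma path_amalgamable_iso:
  assumes "iso S f" "path S g" "Dom S f = Dom S g"
  shows "path_amalgamable S f g"
proof -
  obtain h where h: "iso S h" "Dom S h = Cod S f" "Cod S h = Dom S f" "h \<cdot> f = Ide S (Dom S f)"
    using iso_inverse[OF assms(1)] by blast
  have Arr: "f \<in> Arr S" "h \<in> Arr S" "g \<in> Arr S"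
    using assms h by (auto simp: iso_def path_Arr)
  have "path S (g \<cdot> h)"
    using h assms by (simp add: path_Comp path.Trans iso_Trans)
  moreover have "Dom S (g \<cdot> h) = Cod S f"
    using h assms Arr by (simp add: Comp_Arr)
  moreover have "(g \<cdot> h) \<cdot> f = Ide S (Cod S g) \<cdot> g"
    using h assms Arr by (simp add: Comp_assoc_Arr Comp_Ide_Arr Ide_Comp_Arr)
  moreover have "path S (Ide S (Cod S g))" "Dom S (Ide S (Cod S g)) = Cod S g"
    using Arr by (simp_all add: path_Ide Cod_closed Ide_Arr)
  ultimately show ?thesis
    unfolding path_amalgamable_def by blast
qed

text \<open>The diagram of Newman's lemma: close \<open>s\<close> and \<open>t\<close> by
  \<open>s'\<close> and \<open>t'\<close>, then \<open>f\<close> and \<open>s'\<close> by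
  \<open>a\<close> and \<open>b\<close>, and finally \<open>b \<cdot> t'\<close> and
  \<open>g\<close> by \<open>c\<close> and \<open>d\<close>. The last two assumptions range over all
  paths because \<open>s'\<close> and \<open>b \<cdot> t'\<close> only arise during the
  pasting.\<close>

lemma path_amalgamable_Comp:
  assumes paths: "path S s" "path S t" "path S f" "path S g"
    and dom: "Dom S s = Dom S t" "Dom S f = Cod S s" "Dom S g = Cod S t"
    and st: "path_amalgamable S s t"
    and s: "\<And>p. path S p \<Longrightarrow> Dom S p = Cod S s \<Longrightarrow> path_amalgamable S f p"
    and t: "\<And>p. path S p \<Longrightarrow> Dom S p = Cod S t \<Longrightarrow> path_amalgamable S p g"
  shows "path_amalgamable S (f \<cdot> s) (g \<cdot> t)"
proof -
  obtain s' t' where 1: "path S s'" "path S t'" "Dom S s' = Cod S s" "Dom S t' = Cod S t"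
    "s' \<cdot> s = t' \<cdot> t"
    using st by (auto simp: path_amalgamable_def)
  obtain a b where 2: "path S a" "path S b" "Dom S a = Cod S f" "Dom S b = Cod S s'"
    "a \<cdot> f = b \<cdot> s'"
    using s[OF 1(1,3)] by (auto simp: path_amalgamable_def)
  note Arr = paths[THEN path_Arr] 1(1,2)[THEN path_Arr] 2(1,2)[THEN path_Arr]
  \<comment> \<open>Amalgamability does not record that the two closing paths end at the same
    object; this is read off from the equal composites.\<close>
  have cod: "Cod S s' = Cod S t'"
    using Comp_Arr(3)[OF Arr(1,5) 1(3)] Comp_Arr(3)[OF Arr(2,6) 1(4)] 1(5) by metis
  have "path S (b \<cdot> t')" "Dom S (b \<cdot> t') = Cod S t"
    using 1 2 Arr cod by (auto simp: path_Comp Comp_Arr)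
  from t[OF this] obtain c d where 3: "path S c" "path S d" "Dom S c = Cod S b"
    "Dom S d = Cod S g" "c \<cdot> (b \<cdot> t') = d \<cdot> g"
    using 1 2 Arr cod by (auto simp: path_amalgamable_def Comp_Arr)
  note Arr = Arr 3(1,2)[THEN path_Arr]
  have cod': "Cod S a = Cod S b"
    using Comp_Arr(3)[OF Arr(3,7) 2(3)] Comp_Arr(3)[OF Arr(5,8) 2(4)] 2(5) by metis
  have "(c \<cdot> a) \<cdot> (f \<cdot> s) = c \<cdot> ((a \<cdot> f) \<cdot> s)"
    using 2(3) 3(3) dom Arr cod' by (simp add: Comp_assoc_Arr Comp_Arr)
  also have "\<dots> = c \<cdot> (b \<cdot> (s' \<cdot> s))"
    unfolding 2(5) using 1(3) 2(4) Arr by (simp add: Comp_assoc_Arr)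
  also have "\<dots> = (c \<cdot> (b \<cdot> t')) \<cdot> t"
    unfolding 1(5) using 1(4) 2(4) 3(3) Arr cod by (simp add: Comp_assoc_Arr Comp_Arr)
  also have "\<dots> = d \<cdot> (g \<cdot> t)"
    unfolding 3(5) using 3(4) dom Arr by (simp add: Comp_assoc_Arr)
  finally have "(c \<cdot> a) \<cdot> (f \<cdot> s) = d \<cdot> (g \<cdot> t)" .
  moreover have "path S (c \<cdot> a)" "Dom S (c \<cdot> a) = Cod S (f \<cdot> s)" "Dom S d = Cod S (g \<cdot> t)"
    using 2 3 dom Arr cod' by (simp_all add: path_Comp Comp_Arr)
  ultimately show ?thesis
    using 3(2) unfolding path_amalgamable_def by blast
qed

lemma path_amalgamable_finite:
  assumes "locally_confluent S" "regular S" "terminating S"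
    and "finite_obj S X" "path S f" "path S g" "Dom S f = X" "Dom S g = X"
  shows "path_amalgamable S f g"
  using wf_proper_step[OF assms(3)] assms(4-8)
proof (induction X arbitrary: f g rule: wf_induct_rule)
  case (less X)
  show ?case
    using assms(2) less.prems(2)
  proof (cases rule: path_cases)
    case 1
    then show ?thesis using less.prems by (simp add: path_amalgamable_iso)
  next
    case f: (2 f' s)
    show ?thesis
      using assms(2) less.prems(3)
    proof (cases rule: path_cases)
      case 1
      then show ?thesis
        using less.prems by (simp add: path_amalgamable_iso path_amalgamable_sym)
    next
      case g: (2 g' t)
      have dom: "Dom S s = X" "Dom S t = X"
        using f g less.prems by (simp_all add: Comp_Arr Trans_is_Arr path_Arr)
      have paths: "path S s" "path S t"
        using f g by (simp_all add: path.Trans)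
      \<comment> \<open>Local confluence suffices here, since \<open>s\<close> and \<open>t\<close>
        are single transitions.\<close>
      have "path_amalgamable S s t"
        using assms(1) dom f g less.prems by (auto simp: locally_confluent_def)
      moreover have "(Cod S s, X) \<in> proper_step" "(Cod S t, X) \<in> proper_step"
        using f g dom less.prems by (auto simp: proper_step_def)
      moreover have "finite_obj S (Cod S s)" "finite_obj S (Cod S t)"
        using dom paths less.prems by (simp_all add: finite_obj_Cod)
      ultimately show ?thesis
        \<comment> \<open>Both transitions are proper, so the induction hypothesis is available at
          \<open>Cod S s\<close> for spans containing \<open>f'\<close> and at
          \<open>Cod S t\<close> for spans containing \<open>g'\<close>.\<close>
        unfolding f(5) g(5) using f g dom paths
        by (intro path_amalgamable_Comp) (auto intro: less.IH)
    qed
  qed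
qed

end

theorem corollary5p12:
  fixes S :: "('o, 'a) evsys"
  assumes "evolution_system S"
    and "locally_confluent S"
    and "regular S"
    and "terminating S"
  shows "confluent S"
proof -
  interpret evolution_system S by (fact assms(1))
  show ?thesis
    unfolding confluent_def using path_amalgamable_finite[OF assms(2-4)] by blast
qed

end
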